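(* Let $n$ be the number of robots. For any integer $f$ with $2\le f\le n-1$, there are two target functions $\xi_{(1,n)}$ and $\xi'_{(1,n)}$ such that (1) $\alpha(\xi_{(1,n)})=\alpha(\xi'_{(1,n)})=1$, (2) both $\Phi=\{\xi_{(1,n)}\}$ and $\Phi'=\{\xi'_{(1,n)}\}$ are compatible with respect to the fault-tolerant $(n,f)$-convergence problem FC($f$), but (3) $\Phi\cup\Phi'$ is not compatible with respect to the fault-tolerant $(n,f)$-convergence problem FC($f$).
   Context: Robot model. The number $n$ of robots is given. Robots $r_1,\dots,r_n$ are points in the plane $\mathbb{R}^2$, which carries a fixed right-handed global coordinate system $Z_0$. Time is discrete, $t=0,1,2,\dots$; $\mathbf{x}_t(r_i)$ is the position of $r_i$ at time $t$ in $Z_0$, and the configuration at $t$ is the multiset $P_t=\{\mathbf{x}_t(r_i):1\le i\le n\}$. Robot $r_i$ has a local coordinate system $Z_i$, right-handed, with its own unit length and axis directions, whose origin is always the current position of $r_i$; $\gamma_i$ denotes the coordinate transformation from $Z_i$ to $Z_0$ (so $\gamma_i((0,0))=\mathbf{x}_t(r_i)$ at time $t$). A target function $\phi$ assigns to every multiset $P$ of $n$ points of $\mathbb{R}^2$ an element of $\mathbb{R}^2\cup\{\bot\}$, with $\phi(P)=\bot$ if and only if $(0,0)\notin P$. Each robot $r_i$ is assigned a target function $\phi_i$. The scheduler is semi-synchronous: at each time $t$ an arbitrary subset of robots is activated; if a non-crashed $r_i$ is activated at $t$ then $\mathbf{x}_{t+1}(r_i)=\gamma_i(\phi_i(\gamma_i^{-1}(P_t)))$,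 otherwise $\mathbf{x}_{t+1}(r_i)=\mathbf{x}_t(r_i)$. The schedule is fair: every robot is activated infinitely often. A faulty robot may crash at an arbitrary time, after which it never moves again; crashed robots cannot be distinguished from other robots. Scale. $CH(P)$ is the convex hull of $P$, $g(P)=\frac1n\sum_{\mathbf{x}\in P}\mathbf{x}$ (with multiplicity), and $d*CH(P)=\{d\mathbf{x}+(1-d)g(P):\mathbf{x}\in CH(P)\}$ for $d\ge0$. $\alpha(\phi,P)$ is the smallest $d\ge 0$ with $\phi(P)\in d*CH(P)$ (and $0$ if $\phi(P)=\bot$). The scale of $\phi$ is $\alpha(\phi)=\sup_{P\in(\mathbb{R}^2)^n}\alpha(\phi,P)$. Compatibility. A non-empty set $\Phi$ of target functions is compatible with respect to the fault-tolerant $(n,f)$-convergence problem FC($f$) if, for $n$ robots, for every assignment of target functions from $\Phi$ to the robots (different robots may get different ones), every choice of local coordinate systems, every initial configuration, every fair schedule and every pattern of crashes in which at most $f$ robots are faulty, all non-faulty robots converge to one common point as $t\to\infty$. *)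

theory Defs
  imports "HOL-Analysis.Analysis" "HOL-Library.Multiset"
begin

type_synonym point = "real^2"

text \<open>
  \<^term>\<open>None\<close> is the undefined target. Only the values on multisets of size \<open>n\<close> matter.
\<close>

type_synonym target_fun = "point multiset \<Rightarrow> point option"

definition target_function :: "nat \<Rightarrow> target_fun \<Rightarrow> bool" where
  "target_function n \<phi> \<longleftrightarrow> (\<forall>P. size P = n \<longrightarrow> (\<phi> P = None \<longleftrightarrow> 0 \<notin># P))"

definition CH :: "point multiset \<Rightarrow> point set" where
  "CH P = convex hull (set_mset P)"

definition centroid :: "point multiset \<Rightarrow> point" where
  "centroid P = (1 / real (size P)) *\<^sub>R sum_mset P"

definition scaled_CH :: "real \<Rightarrow> point multiset \<Rightarrow> point set" where
  "scaled_CH d P = (\<lambda>x. d *\<^sub>R x + (1 - d) *\<^sub>R centroid P) ` CH P"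

text \<open>
  The admissible \<open>d\<close> form a closed set, so the least one exists as soon as there is any.
  There is none if the target lies outside the affine hull of \<open>P\<close>; the scale is then infinite.
\<close>

definition scale_at :: "target_fun \<Rightarrow> point multiset \<Rightarrow> ereal" where
  "scale_at \<phi> P = (case \<phi> P of
       None \<Rightarrow> 0
     | Some y \<Rightarrow>
         if \<exists>d\<ge>0. y \<in> scaled_CH d P
         then ereal (LEAST d. 0 \<le> d \<and> y \<in> scaled_CH d P)
         else \<infinity>)"

definition target_scale :: "nat \<Rightarrow> target_fun \<Rightarrow> ereal" where
  "target_scale n \<phi> = (SUP P \<in> {P. size P = n}. scale_at \<phi> P)"

text \<open>
  \<open>to_global u \<theta> x\<close> maps coordinates in the right-handed system with origin \<open>x\<close>, unit length
  \<open>u > 0\<close> and first axis at angle \<open>\<theta>\<close> to global coordinates.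
\<close>

definition rotate_point :: "real \<Rightarrow> point \<Rightarrow> point" where
  "rotate_point \<theta> p = vector [cos \<theta> * p$1 - sin \<theta> * p$2, sin \<theta> * p$1 + cos \<theta> * p$2]"

definition to_global :: "real \<Rightarrow> real \<Rightarrow> point \<Rightarrow> point \<Rightarrow> point" where
  "to_global u \<theta> x p = x + u *\<^sub>R rotate_point \<theta> p"

text \<open>
  Robots are the numbers below \<open>n\<close>; \<open>x t i\<close> is the position of robot \<open>i\<close> at time \<open>t\<close>.
  \<open>crash i = Some k\<close> means that robot \<open>i\<close> crashes at time \<open>k\<close>, and \<open>None\<close> that it is non-faulty.
\<close>

definition configuration :: "nat \<Rightarrow> (nat \<Rightarrow> point) \<Rightarrow> point multiset" where
  "configuration n pos = image_mset pos (mset_set {..<n})"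

definition crashed :: "(nat \<Rightarrow> nat option) \<Rightarrow> nat \<Rightarrow> nat \<Rightarrow> bool" where
  "crashed crash t i \<longleftrightarrow> (\<exists>k\<le>t. crash i = Some k)"

definition faulty :: "nat \<Rightarrow> (nat \<Rightarrow> nat option) \<Rightarrow> nat set" where
  "faulty n crash = {i. i < n \<and> crash i \<noteq> None}"

definition fair :: "nat \<Rightarrow> (nat \<Rightarrow> nat set) \<Rightarrow> bool" where
  "fair n active \<longleftrightarrow> (\<forall>i<n. infinite {t. i \<in> active t})"

text \<open>
  The observing robot sees itself at the local origin, so \<^const>\<open>the\<close> is never applied to
  \<^term>\<open>None\<close> when its target function satisfies \<^const>\<open>target_function\<close>.
\<close>

definition destination :: "nat \<Rightarrow> target_fun \<Rightarrow> real \<Rightarrow> real \<Rightarrow> (nat \<Rightarrow> point) \<Rightarrow> nat \<Rightarrow> point" where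
  "destination n \<phi> u \<theta> pos i =
     (let \<gamma> = to_global u \<theta> (pos i)
      in \<gamma> (the (\<phi> (image_mset (inv \<gamma>) (configuration n pos)))))"

definition execution ::
  "nat \<Rightarrow> (nat \<Rightarrow> target_fun) \<Rightarrow> (nat \<Rightarrow> real) \<Rightarrow> (nat \<Rightarrow> real) \<Rightarrow> (nat \<Rightarrow> nat set) \<Rightarrow>
   (nat \<Rightarrow> nat option) \<Rightarrow> (nat \<Rightarrow> nat \<Rightarrow> point) \<Rightarrow> bool" where
  "execution n \<phi> u \<theta> active crash x \<longleftrightarrow>
     (\<forall>t. \<forall>i<n. x (Suc t) i =
        (if i \<in> active t \<and> \<not> crashed crash t i
         then destination n (\<phi> i) (u i) (\<theta> i) (x t) i
         else x t i))"

text \<open>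
  The initial configuration is universally quantified through \<open>x 0\<close>.
\<close>

definition FC_compatible :: "nat \<Rightarrow> nat \<Rightarrow> target_fun set \<Rightarrow> bool" where
  "FC_compatible n f \<Phi> \<longleftrightarrow>
     (\<forall>\<phi> u \<theta> active crash x.
        (\<forall>i<n. \<phi> i \<in> \<Phi>) \<and> (\<forall>i<n. 0 < u i) \<and> fair n active \<and>
        card (faulty n crash) \<le> f \<and> execution n \<phi> u \<theta> active crash x \<longrightarrow>
        (\<exists>p. \<forall>i<n. i \<notin> faulty n crash \<longrightarrow> (\<lambda>t. x t i) \<longlonglongrightarrow> p))"

end

theory Submission
  imports Defs
begin

text \<open>
  Both target functions send a robot to the centroid, except when \<open>n - 1\<close> robots share a
  position \<open>a\<close>: then the first one (\<open>join_majority\<close>) sends every robot to \<open>a\<close>, while under the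
  second one (\<open>stay_alone\<close>) a robot that sees all others at \<open>a\<close> stays where it is. If the robot
  apart from the other \<open>n - 1\<close> runs \<open>stay_alone\<close> and the others run \<open>join_majority\<close>, nobody ever
  moves.

  Each function on its own is a centroid rule with interruptions. If every robot jumps to the
  current centroid infinitely often, all converge to one point: in each coordinate the maximum
  decreases to some \<open>L\<close>, and the centroid must come up to \<open>L\<close> again and again, or else all robots
  would end up below \<open>L\<close>; this forces the minimum to approach \<open>L\<close> too. If the robots of a
  non-empty set \<open>C\<close> jump only finitely often, they are eventually stationary, and the same
  argument for the maximal distance shows that the others converge to the mean of \<open>C\<close>.
\<close>

section \<open>Coordinate changes\<close>

lemma rotate_point_inverse: "rotate_point \<theta> (rotate_point (-\<theta>) p) = p"
proof -
  have "cos \<theta> * (cos \<theta> * a) + sin \<theta> * (sin \<theta> * a) = a" for a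
  proof -
    have "cos \<theta> * (cos \<theta> * a) + sin \<theta> * (sin \<theta> * a) = ((sin \<theta>)\<^sup>2 + (cos \<theta>)\<^sup>2) * a"
      by (simp only: power2_eq_square algebra_simps)
    then show ?thesis by (simp only: sin_cos_squared_add mult_1_left)
  qed
  \<comment> \<open>The two coordinates of the composed rotation give this identity with its
    summands in opposite orders.\<close>
  note * = this this[unfolded add.commute[of "cos \<theta> * _"]]
  show ?thesis
    unfolding rotate_point_def vec_eq_iff forall_2 by (simp add: right_diff_distrib distrib_left *)
qed

lemma rotate_point_add: "rotate_point \<theta> (p + q) = rotate_point \<theta> p + rotate_point \<theta> q"
  unfolding rotate_point_def vec_eq_iff forall_2 by (simp add: algebra_simps)

lemma rotate_point_scaleR: "rotate_point \<theta> (c *\<^sub>R p) = c *\<^sub>R rotate_point \<theta> p"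
  unfolding rotate_point_def vec_eq_iff forall_2 by (simp add: algebra_simps)

lemma to_global_origin: "to_global u \<theta> x 0 = x"
  using rotate_point_scaleR[of \<theta> 0 0] by (simp add: to_global_def)

lemma bij_to_global:
  assumes "0 < u"
  shows "bij (to_global u \<theta> x)"
proof (rule o_bij)
  let ?\<delta> = "\<lambda>p. (1 / u) *\<^sub>R rotate_point (-\<theta>) (p - x)"
  show "to_global u \<theta> x \<circ> ?\<delta> = id"
    using assms rotate_point_inverse[of \<theta>]
    by (auto simp: to_global_def rotate_point_scaleR)
  show "?\<delta> \<circ> to_global u \<theta> x = id"
    using assms rotate_point_inverse[of "-\<theta>"]
    by (auto simp: to_global_def rotate_point_scaleR)
qed

text \<open>Affine maps commute with averages. Non-emptiness matters: the empty multiset has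
  centroid 0 by default, and 0 is sent to \<open>x\<close>.\<close>

lemma centroid_to_global:
  assumes "Q \<noteq> {#}"
  shows "centroid (image_mset (to_global u \<theta> x) Q) = to_global u \<theta> x (centroid Q)"
proof -
  have "sum_mset (image_mset (to_global u \<theta> x) Q) =
      real (size Q) *\<^sub>R x + u *\<^sub>R rotate_point \<theta> (sum_mset Q)"
  proof (induction Q)
    case empty
    show ?case using rotate_point_scaleR[of \<theta> 0 0] by simp
  next
    case (add p Q)
    then show ?case
      by (simp add: to_global_def rotate_point_add algebra_simps)
  qed
  then show ?thesis
    using assms
    by (simp add: centroid_def to_global_def rotate_point_scaleR algebra_simps)
qed

section \<open>The two target functions\<close>

text \<open>The odd point \<open>b\<close> may equal \<open>a\<close>, so the predicate survives
  when the last robot joins the others.\<close>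

definition majority :: "nat \<Rightarrow> point multiset \<Rightarrow> point \<Rightarrow> bool" where
  "majority n P a \<longleftrightarrow> (\<exists>b. P = add_mset b (replicate_mset (n - 1) a))"

definition join_majority :: "nat \<Rightarrow> point multiset \<Rightarrow> point" where
  "join_majority n P = (if \<exists>a. majority n P a then THE a. majority n P a else centroid P)"

text \<open>The observer is the point 0 of its own view, so this pattern, unlike
  \<open>majority\<close>, depends on who looks; target 0 means staying put.\<close>

definition stay_alone :: "nat \<Rightarrow> point multiset \<Rightarrow> point" where
  "stay_alone n P = (if \<exists>a. P = add_mset 0 (replicate_mset (n - 1) a) then 0 else centroid P)"

definition target_to :: "(point multiset \<Rightarrow> point) \<Rightarrow> target_fun" where
  "target_to g P = (if 0 \<in># P then Some (g P) else None)"

lemma target_function_target_to: "target_function n (target_to g)"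
  by (simp add: target_function_def target_to_def)

text \<open>A majority point has multiplicity at least \<open>n - 1\<close>, hence at least 2, while
  every point other than \<open>a'\<close> occurs at most once.\<close>

lemma majority_unique:
  assumes "3 \<le> n" "majority n P a" "majority n P a'"
  shows "a' = a"
proof (rule ccontr)
  assume "a' \<noteq> a"
  obtain b b' where P: "P = add_mset b (replicate_mset (n - 1) a)"
      and P': "P = add_mset b' (replicate_mset (n - 1) a')"
    using assms(2,3) unfolding majority_def by blast
  have "n - 1 \<le> count P a" unfolding P by simp
  moreover have "count P a \<le> 1" unfolding P' using \<open>a' \<noteq> a\<close> by simp
  ultimately show False using assms(1) by simp
qed

lemma join_majority_eq:
  assumes "3 \<le> n" "majority n P a"
  shows "join_majority n P = a"
proof -
  have "(THE a. majority n P a) = a"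
    using assms(2) by (rule the_equality) (rule majority_unique[OF assms])
  then show ?thesis using assms(2) by (auto simp: join_majority_def)
qed

section \<open>Configurations and destinations in global coordinates\<close>

lemma size_configuration: "size (configuration n pos) = n"
  by (simp add: configuration_def)

lemma configuration_split:
  assumes "i < n"
  shows "configuration n pos = add_mset (pos i) (image_mset pos (mset_set ({..<n} - {i})))"
  using assms mset_set.remove[of "{..<n}" i] by (simp add: configuration_def)

text \<open>Multisets forget who is where; naming \<open>pos i\<close> as the odd element recovers
  it, since cancelling that element leaves exactly the positions of the other robots.\<close>

lemma configuration_eq_add_replicate:
  assumes "i < n"
  shows "configuration n pos = add_mset (pos i) (replicate_mset (n - 1) a) \<longleftrightarrow>
    (\<forall>j<n. j \<noteq> i \<longrightarrow> pos j = a)" (is "?L \<longleftrightarrow> ?R")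
proof
  assume ?L
  then have "image_mset pos (mset_set ({..<n} - {i})) = replicate_mset (n - 1) a"
    using configuration_split[OF assms, of pos] by simp
  then have "pos ` ({..<n} - {i}) = set_mset (replicate_mset (n - 1) a)"
    by (metis finite_Diff finite_lessThan finite_set_mset_mset_set set_image_mset)
  then show ?R by (auto split: if_splits)
next
  assume ?R
  then have "image_mset pos (mset_set ({..<n} - {i})) = image_mset (\<lambda>_. a) (mset_set ({..<n} - {i}))"
    by (intro image_mset_cong) auto
  also have "\<dots> = replicate_mset (n - 1) a"
    using assms by (simp add: image_mset_const_eq card_Diff_singleton)
  finally show ?L
    using configuration_split[OF assms, of pos] by simp
qed

lemma majority_configuration:
  "majority n (configuration n pos) a \<longleftrightarrow> (\<exists>i<n. \<forall>j<n. j \<noteq> i \<longrightarrow> pos j = a)"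
    (is "_ \<longleftrightarrow> ?R")
proof
  assume "majority n (configuration n pos) a"
  then obtain b where b: "configuration n pos = add_mset b (replicate_mset (n - 1) a)"
    by (auto simp: majority_def)
  then have "b \<in># configuration n pos" by simp
  then obtain i where i: "i < n" "b = pos i" by (auto simp: configuration_def)
  have "\<forall>j<n. j \<noteq> i \<longrightarrow> pos j = a"
    using b i configuration_eq_add_replicate[OF i(1), of pos a] by simp
  then show ?R using i(1) by auto
next
  assume ?R
  then obtain i where i: "i < n" "\<forall>j<n. j \<noteq> i \<longrightarrow> pos j = a" by blast
  have "configuration n pos = add_mset (pos i) (replicate_mset (n - 1) a)"
    using configuration_eq_add_replicate[OF i(1), of pos a] i(2) by simp
  then show "majority n (configuration n pos) a"
    unfolding majority_def by (rule exI)
qed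

lemma centroid_configuration:
  "centroid (configuration n pos) = (1 / real n) *\<^sub>R (\<Sum>j<n. pos j)"
  by (simp add: centroid_def size_configuration configuration_def sum_unfold_sum_mset)

text \<open>\<open>Q\<close> is the view of robot \<open>i\<close>. Describing it through its image
  under the coordinate map lets patterns be carried between local and global coordinates. The view
  contains 0, so the target is defined.\<close>

lemma destination_target_to:
  assumes "i < n" "0 < u"
  obtains Q where "destination n (target_to g) u \<theta> pos i = to_global u \<theta> (pos i) (g Q)"
    and "configuration n pos = image_mset (to_global u \<theta> (pos i)) Q" "Q \<noteq> {#}"
proof
  let ?\<gamma> = "to_global u \<theta> (pos i)"
  let ?Q = "image_mset (inv ?\<gamma>) (configuration n pos)"
  have bij: "bij ?\<gamma>" by (rule bij_to_global[OF assms(2)])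
  have "inv ?\<gamma> (pos i) = 0"
    using bij to_global_origin[of u \<theta> "pos i"] by (metis bij_is_inj inv_f_f)
  then have "0 \<in># ?Q"
    using configuration_split[OF assms(1), of pos] by simp
  then show "destination n (target_to g) u \<theta> pos i = ?\<gamma> (g ?Q)"
    by (simp add: destination_def target_to_def Let_def)
  show "configuration n pos = image_mset ?\<gamma> ?Q"
    using bij by (simp add: multiset.map_comp comp_def surj_f_inv_f bij_is_surj)
  show "?Q \<noteq> {#}" using \<open>0 \<in># ?Q\<close> by auto
qed

text \<open>The coordinate map is bijective, so a majority exists locally iff it exists globally,
  and affine, so centroids agree. Hence all robots share one global target.\<close>

lemma destination_join_majority:
  assumes "3 \<le> n" "i < n" "0 < u"
  shows "destination n (target_to (join_majority n)) u \<theta> pos i = join_majority n (configuration n pos)"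
proof -
  obtain Q where Q: "destination n (target_to (join_majority n)) u \<theta> pos i =
        to_global u \<theta> (pos i) (join_majority n Q)"
      "configuration n pos = image_mset (to_global u \<theta> (pos i)) Q" "Q \<noteq> {#}"
    using destination_target_to[OF assms(2,3)] .
  have bij: "bij (to_global u \<theta> (pos i))" by (rule bij_to_global[OF assms(3)])
  show ?thesis
  proof (cases "\<exists>a. majority n Q a")
    case True
    then obtain a where a: "majority n Q a" ..
    then have "majority n (configuration n pos) (to_global u \<theta> (pos i) a)"
      unfolding Q(2) by (auto simp: majority_def)
    then show ?thesis using join_majority_eq[OF assms(1)] a Q(1) by simp
  next
    case False
    have "Q = image_mset (inv (to_global u \<theta> (pos i))) (configuration n pos)"
      unfolding Q(2) using bij by (simp add: multiset.map_comp comp_def inv_f_f bij_is_inj)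
    then have "majority n (configuration n pos) a \<Longrightarrow> majority n Q (inv (to_global u \<theta> (pos i)) a)" for a
      by (auto simp: majority_def)
    then have "\<nexists>a. majority n (configuration n pos) a" using False by blast
    then have "join_majority n (configuration n pos) = centroid (configuration n pos)"
      by (simp add: join_majority_def)
    moreover have "join_majority n Q = centroid Q"
      using False by (simp add: join_majority_def)
    ultimately show ?thesis
      using Q by (simp add: centroid_to_global)
  qed
qed

text \<open>The same transfer between coordinates, with the odd point tied to the observer: its
  local 0 corresponds to \<open>pos i\<close>.\<close>

lemma destination_stay_alone:
  assumes "i < n" "0 < u"
  shows "destination n (target_to (stay_alone n)) u \<theta> pos i =
    (if \<exists>a. \<forall>j<n. j \<noteq> i \<longrightarrow> pos j = a then pos i else centroid (configuration n pos))"
proof -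
  let ?\<gamma> = "to_global u \<theta> (pos i)"
  obtain Q where Q: "destination n (target_to (stay_alone n)) u \<theta> pos i = ?\<gamma> (stay_alone n Q)"
      "configuration n pos = image_mset ?\<gamma> Q" "Q \<noteq> {#}"
    using destination_target_to[OF assms] .
  have bij: "bij ?\<gamma>" by (rule bij_to_global[OF assms(2)])
  have inv0: "inv ?\<gamma> (pos i) = 0"
    using bij to_global_origin[of u \<theta> "pos i"] by (metis bij_is_inj inv_f_f)
  have Q': "Q = image_mset (inv ?\<gamma>) (configuration n pos)"
    unfolding Q(2) using bij by (simp add: multiset.map_comp comp_def inv_f_f bij_is_inj)
  have "(\<exists>a. Q = add_mset 0 (replicate_mset (n - 1) a)) \<longleftrightarrow>
      (\<exists>a. configuration n pos = add_mset (pos i) (replicate_mset (n - 1) a))"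
  proof
    assume "\<exists>a. Q = add_mset 0 (replicate_mset (n - 1) a)"
    then obtain a where "Q = add_mset 0 (replicate_mset (n - 1) a)" ..
    then have "configuration n pos = add_mset (pos i) (replicate_mset (n - 1) (?\<gamma> a))"
      unfolding Q(2) by (simp add: to_global_origin)
    then show "\<exists>a. configuration n pos = add_mset (pos i) (replicate_mset (n - 1) a)" ..
  next
    assume "\<exists>a. configuration n pos = add_mset (pos i) (replicate_mset (n - 1) a)"
    then obtain a where "configuration n pos = add_mset (pos i) (replicate_mset (n - 1) a)" ..
    then have "Q = add_mset 0 (replicate_mset (n - 1) (inv ?\<gamma> a))"
      unfolding Q' by (simp add: inv0)
    then show "\<exists>a. Q = add_mset 0 (replicate_mset (n - 1) a)" ..
  qed
  then have "(\<exists>a. Q = add_mset 0 (replicate_mset (n - 1) a)) \<longleftrightarrow> (\<exists>a. \<forall>j<n. j \<noteq> i \<longrightarrow> pos j = a)"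
    using configuration_eq_add_replicate[OF assms(1), of pos] by simp
  moreover have "?\<gamma> (centroid Q) = centroid (configuration n pos)"
    using centroid_to_global[OF Q(3)] Q(2) by simp
  ultimately show ?thesis
    unfolding Q(1) stay_alone_def by (auto simp: to_global_origin)
qed

section \<open>Scale\<close>

text \<open>At \<open>d = 0\<close> the scaled hull shrinks to the centroid; it is non-empty because
  \<open>P\<close> is.\<close>

lemma scale_at_centroid:
  assumes "\<phi> P = Some (centroid P)" "P \<noteq> {#}"
  shows "scale_at \<phi> P = 0"
proof -
  obtain p where "p \<in># P" using assms(2) by blast
  then have "p \<in> CH P" by (simp add: CH_def hull_inc)
  then have "centroid P \<in> scaled_CH 0 P" by (force simp: scaled_CH_def)
  moreover from this have "(LEAST d. 0 \<le> d \<and> centroid P \<in> scaled_CH d P) = 0"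
    by (intro Least_equality) auto
  ultimately show ?thesis using assms(1)
    by (auto simp: scale_at_def zero_ereal_def)
qed

text \<open>With \<open>d < 1\<close> the target would lie strictly between the centroid and another
  point of the hull, contradicting extremality.\<close>

lemma scale_at_extreme_point:
  assumes "\<phi> P = Some y" "y extreme_point_of CH P" "y \<noteq> centroid P" "centroid P \<in> CH P"
  shows "scale_at \<phi> P = 1"
proof -
  have y: "y \<in> CH P" using assms(2) by (simp add: extreme_point_of_def)
  then have y1: "y \<in> scaled_CH 1 P" by (simp add: scaled_CH_def)
  have "1 \<le> d" if d: "0 \<le> d" "y \<in> scaled_CH d P" for d
  proof (rule ccontr)
    assume "\<not> 1 \<le> d"
    obtain x where x: "x \<in> CH P" "y = d *\<^sub>R x + (1 - d) *\<^sub>R centroid P"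
      using d(2) by (auto simp: scaled_CH_def)
    have "d \<noteq> 0" using x(2) assms(3) by auto
    have "x \<noteq> centroid P" using x(2) assms(3) by (auto simp: algebra_simps)
    then have "y \<in> open_segment (centroid P) x"
      using x(2) \<open>0 \<le> d\<close> \<open>d \<noteq> 0\<close> \<open>\<not> 1 \<le> d\<close>
      by (auto simp: in_segment intro!: exI[of _ d])
    then show False using assms(2,4) x(1) by (auto simp: extreme_point_of_def)
  qed
  then have "(LEAST d. 0 \<le> d \<and> y \<in> scaled_CH d P) = 1"
    using y1 by (intro Least_equality) auto
  moreover have "\<exists>d\<ge>0. y \<in> scaled_CH d P" using y1 by (intro exI[of _ 1]) simp
  ultimately show ?thesis using assms(1)
    by (simp add: scale_at_def one_ereal_def)
qed

text \<open>
  The library's simp rule \<open>sum_mset_replicate_mset\<close> would produce a componentwise product of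
  vectors, so it is switched off where this lemma is used.
\<close>

lemma sum_mset_replicate_vec: "sum_mset (replicate_mset k a) = real k *\<^sub>R (a :: point)"
  by (induction k) (simp_all add: algebra_simps)

text \<open>The hull is a segment, its endpoints are extreme, and the centroid lies strictly inside,
  at parameter \<open>1 / real n\<close>.\<close>

lemma scale_at_two_points:
  fixes a b :: point
  assumes "3 \<le> n" "a \<noteq> b" "P = add_mset b (replicate_mset (n - 1) a)" "\<phi> P = Some y" "y = a \<or> y = b"
  shows "scale_at \<phi> P = 1"
proof -
  have CH: "CH P = closed_segment a b"
    using assms(1,3) by (simp add: CH_def segment_convex_hull insert_commute)
  have "centroid P = (1 / real n) *\<^sub>R (b + real (n - 1) *\<^sub>R a)"
    using assms(1,3) by (simp add: centroid_def sum_mset_replicate_vec del: sum_mset_replicate_mset)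
  also have "\<dots> = (1 - 1 / real n) *\<^sub>R a + (1 / real n) *\<^sub>R b"
    using assms(1) by (simp add: algebra_simps of_nat_diff diff_divide_distrib)
  finally have c: "centroid P = (1 - 1 / real n) *\<^sub>R a + (1 / real n) *\<^sub>R b" .
  then have "centroid P \<in> open_segment a b"
    using assms(1,2) by (auto simp: in_segment intro!: exI[of _ "1 / real n"])
  then show ?thesis
    using scale_at_extreme_point[of \<phi> P y] assms(4,5) CH
    by (auto simp: extreme_point_of_segment open_segment_def)
qed

text \<open>By \<open>rule\<close> every scale is 0 or 1, and \<open>exc\<close> provides a multiset
  of the right size where 1 is attained.\<close>

lemma target_scale_eq_1:
  assumes n: "3 \<le> n"
    and rule: "\<And>P. size P = n \<Longrightarrow> 0 \<in># P \<Longrightarrow> g P = centroid P \<or>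
      (\<exists>a b. P = add_mset b (replicate_mset (n - 1) a) \<and> a \<noteq> b \<and> (g P = a \<or> g P = b))"
    and exc: "\<exists>P a b. 0 \<in># P \<and> P = add_mset b (replicate_mset (n - 1) a) \<and> a \<noteq> b \<and> (g P = a \<or> g P = b)"
  shows "target_scale n (target_to g) = 1"
proof -
  have "scale_at (target_to g) P \<le> 1" if P: "size P = n" for P
  proof (cases "0 \<in># P")
    case True
    then have g: "target_to g P = Some (g P)" by (simp add: target_to_def)
    have "P \<noteq> {#}" using True by auto
    from rule[OF P True] show ?thesis
    proof
      assume "g P = centroid P"
      then show ?thesis
        using scale_at_centroid[of "target_to g" P] g \<open>P \<noteq> {#}\<close> by simp
    next
      assume "\<exists>a b. P = add_mset b (replicate_mset (n - 1) a) \<and> a \<noteq> b \<and> (g P = a \<or> g P = b)"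
      then obtain a b where "P = add_mset b (replicate_mset (n - 1) a)" "a \<noteq> b" "g P = a \<or> g P = b"
        by blast
      then show ?thesis
        using scale_at_two_points[of n a b P "target_to g" "g P"] g n by simp
    qed
  next
    case False
    then show ?thesis by (simp add: target_to_def scale_at_def)
  qed
  moreover obtain P where "size P = n" "scale_at (target_to g) P = 1"
  proof -
    obtain P a b where P: "0 \<in># P" "P = add_mset b (replicate_mset (n - 1) a)" "a \<noteq> b" "g P = a \<or> g P = b"
      using exc by blast
    show ?thesis
    proof (rule that)
      show "size P = n" using n P(2) by simp
      show "scale_at (target_to g) P = 1"
        using scale_at_two_points[OF n P(3,2), of "target_to g" "g P"] P(1,4)
        by (simp add: target_to_def)
    qed
  qed
  ultimately show ?thesis
    unfolding target_scale_def
    by (intro antisym SUP_least SUP_upper2[of P]) simp_all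
qed

text \<open>Covers the case \<open>a = b\<close> of the pattern, where the exceptional target
  coincides with the centroid.\<close>

lemma centroid_replicate:
  assumes "0 < n" "P = add_mset a (replicate_mset (n - 1) a)"
  shows "centroid P = a"
proof -
  have P: "P = replicate_mset n a" using assms by (cases n) auto
  show ?thesis
    unfolding P centroid_def using assms(1)
    by (simp add: sum_mset_replicate_vec del: sum_mset_replicate_mset)
qed

lemma target_scale_join_majority:
  assumes "3 \<le> n"
  shows "target_scale n (target_to (join_majority n)) = 1"
proof (rule target_scale_eq_1[OF assms])
  fix P :: "point multiset"
  show "join_majority n P = centroid P \<or>
      (\<exists>a b. P = add_mset b (replicate_mset (n - 1) a) \<and> a \<noteq> b \<and>
        (join_majority n P = a \<or> join_majority n P = b))"
  proof (cases "\<exists>a. majority n P a")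
    case True
    then obtain a b where ab: "majority n P a" "P = add_mset b (replicate_mset (n - 1) a)"
      unfolding majority_def by blast
    have "join_majority n P = a" by (rule join_majority_eq[OF assms ab(1)])
    moreover have "centroid P = a" if "a = b"
      using centroid_replicate[of n P a] ab(2) assms that by simp
    ultimately show ?thesis using ab(2) by metis
  next
    case False
    then show ?thesis by (simp add: join_majority_def)
  qed
next
  \<comment> \<open>The view of an observer alone at the origin, with all others at a unit
    vector.\<close>
  let ?a = "axis 1 1 :: point"
  let ?P = "add_mset 0 (replicate_mset (n - 1) ?a)"
  have "join_majority n ?P = ?a"
    using join_majority_eq[OF assms] unfolding majority_def by blast
  moreover have "?a \<noteq> 0" by (simp add: axis_eq_0_iff)
  ultimately show "\<exists>P a b. 0 \<in># P \<and> P = add_mset b (replicate_mset (n - 1) a) \<and> a \<noteq> b \<and>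
      (join_majority n P = a \<or> join_majority n P = b)"
    by (intro exI[of _ ?P] exI[of _ ?a] exI[of _ 0]) simp
qed

lemma target_scale_stay_alone:
  assumes "3 \<le> n"
  shows "target_scale n (target_to (stay_alone n)) = 1"
proof (rule target_scale_eq_1[OF assms])
  fix P :: "point multiset"
  show "stay_alone n P = centroid P \<or>
      (\<exists>a b. P = add_mset b (replicate_mset (n - 1) a) \<and> a \<noteq> b \<and>
        (stay_alone n P = a \<or> stay_alone n P = b))"
  proof (cases "\<exists>a. P = add_mset 0 (replicate_mset (n - 1) a)")
    case True
    then obtain a where a: "P = add_mset 0 (replicate_mset (n - 1) a)" ..
    have "stay_alone n P = 0" using True by (simp add: stay_alone_def)
    moreover have "centroid P = 0" if "a = 0"
      using centroid_replicate[of n P a] a assms that by simp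
    ultimately show ?thesis using a by metis
  next
    case False
    then show ?thesis by (simp add: stay_alone_def)
  qed
next
  let ?a = "axis 1 1 :: point"
  let ?P = "add_mset 0 (replicate_mset (n - 1) ?a)"
  have "stay_alone n ?P = 0" unfolding stay_alone_def by (rule if_P) blast
  moreover have "?a \<noteq> 0" by (simp add: axis_eq_0_iff)
  ultimately show "\<exists>P a b. 0 \<in># P \<and> P = add_mset b (replicate_mset (n - 1) a) \<and> a \<noteq> b \<and>
      (stay_alone n P = a \<or> stay_alone n P = b)"
    by (intro exI[of _ ?P] exI[of _ ?a] exI[of _ 0]) simp
qed

section \<open>Averaging with stationary agents\<close>

text \<open>A value is kept or replaced by one of at most \<open>G t\<close>, which does not exceed
  the current maximum. \<open>G\<close> stays abstract to cover a mean, its negative and a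
  contracted maximum.\<close>

lemma decseq_Max:
  fixes h :: "nat \<Rightarrow> 'a \<Rightarrow> real"
  assumes "finite S" "S \<noteq> {}"
    and step: "\<And>t i. i \<in> S \<Longrightarrow> h (Suc t) i = h t i \<or> h (Suc t) i \<le> G t"
    and G: "\<And>t. G t \<le> Max (h t ` S)"
  shows "decseq (\<lambda>t. Max (h t ` S))"
proof (rule decseq_SucI)
  fix t
  have "h (Suc t) i \<le> Max (h t ` S)" if "i \<in> S" for i
    using step[OF that, of t] G[of t] assms(1) that by (auto intro: order_trans Max_ge)
  then show "Max (h (Suc t) ` S) \<le> Max (h t ` S)"
    using assms(1,2) by auto
qed

text \<open>If \<open>G\<close> were eventually below \<open>L\<close>, each index would fall below
  \<open>L\<close> at its next move and stay there, since later values are kept or bounded by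
  \<open>G\<close>. As \<open>S\<close> is finite, the maximum would then be below
  \<open>L\<close>.\<close>

lemma frequently_ge_if_Max_ge:
  fixes h :: "nat \<Rightarrow> 'a \<Rightarrow> real"
  assumes "finite S" "S \<noteq> {}"
    and step: "\<And>t i. i \<in> S \<Longrightarrow> h (Suc t) i = h t i \<or> h (Suc t) i \<le> G t"
    and moves: "\<And>i. i \<in> S \<Longrightarrow> infinite {t. h (Suc t) i \<le> G t}"
    and L: "\<And>t. L \<le> Max (h t ` S)"
  shows "\<exists>\<^sub>F t in sequentially. L \<le> G t"
proof (rule ccontr)
  assume "\<not> (\<exists>\<^sub>F t in sequentially. L \<le> G t)"
  then obtain T where T: "\<And>t. T \<le> t \<Longrightarrow> G t < L"
    by (auto simp: not_frequently eventually_sequentially not_le)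
  have "\<forall>\<^sub>F t in sequentially. h t i < L" if i: "i \<in> S" for i
  proof -
    obtain s where s: "T \<le> s" "h (Suc s) i \<le> G s"
      using moves[OF i] by (auto simp: infinite_nat_iff_unbounded_le)
    have "h t i < L" if "Suc s \<le> t" for t
      using that
    proof (induction t rule: dec_induct)
      case base
      show ?case using s T[of s] by simp
    next
      case (step t)
      then show ?case using assms(3)[OF i, of t] T[of t] s(1) by force
    qed
    then show ?thesis by (auto simp: eventually_sequentially)
  qed
  then have "\<forall>\<^sub>F t in sequentially. \<forall>i\<in>S. h t i < L"
    using assms(1) by (simp add: eventually_ball_finite)
  then obtain t where "\<forall>i\<in>S. h t i < L"
    by (auto simp: eventually_sequentially)
  then have "Max (h t ` S) < L" using assms(1,2) by simp
  then show False using L[of t] by simp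
qed

section \<open>Convergence when every robot keeps jumping to the centroid\<close>

lemma averaging_coordinate_converges:
  fixes h :: "nat \<Rightarrow> nat \<Rightarrow> real"
  assumes "0 < n"
    and step: "\<And>t i. i < n \<Longrightarrow> h (Suc t) i = h t i \<or> h (Suc t) i = (1 / real n) * (\<Sum>j<n. h t j)"
    and moves: "\<And>i. i < n \<Longrightarrow> infinite {t. h (Suc t) i = (1 / real n) * (\<Sum>j<n. h t j)}"
  shows "\<exists>l. \<forall>i<n. (\<lambda>t. h t i) \<longlonglongrightarrow> l"
proof -
  define g where "g t = (1 / real n) * (\<Sum>j<n. h t j)" for t
  define M where "M t = Max (h t ` {..<n})" for t
  \<comment> \<open>Minus the minimum, so that the lemmas on maxima serve both ends.\<close>
  define M' where "M' t = Max ((\<lambda>i. - h t i) ` {..<n})" for t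
  have S: "finite {..<n}" "{..<n} \<noteq> {}" using assms(1) by auto
  have M: "h t i \<le> M t" "- h t i \<le> M' t" if "i < n" for t i
    using that by (auto simp: M_def M'_def)
  \<comment> \<open>One index attains the minimum \<open>- M' t\<close>; the other
    \<open>n - 1\<close> values are at most \<open>M t\<close>.\<close>
  have gM: "real n * g t \<le> (real n - 1) * M t - M' t" for t
  proof -
    have "M' t \<in> (\<lambda>i. - h t i) ` {..<n}"
      unfolding M'_def using S by (intro Max_in) auto
    then obtain i where i: "i < n" "h t i = - M' t" by auto
    have "real n * g t = h t i + (\<Sum>j\<in>{..<n} - {i}. h t j)"
      using i(1) assms(1) by (simp add: g_def sum.remove[of _ i])
    also have "(\<Sum>j\<in>{..<n} - {i}. h t j) \<le> real (card ({..<n} - {i})) * M t"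
      using M by (intro sum_bounded_above) auto
    finally show ?thesis using i by (simp add: of_nat_diff Suc_leI)
  qed
  have M'M: "- M' t \<le> M t" for t using M[OF assms(1), of t] by linarith
  have gM1: "g t \<le> M t" for t
  proof -
    have "real n * g t \<le> real n * M t" using gM[of t] M'M[of t] by (simp add: algebra_simps)
    then show ?thesis using assms(1) by simp
  qed
  have gM2: "- g t \<le> M' t" for t
  proof -
    have "(\<Sum>j<n. - h t j) \<le> real (card {..<n}) * M' t"
      using M by (intro sum_bounded_above) auto
    then have "real n * (- g t) \<le> real n * M' t"
      using assms(1) by (simp add: g_def sum_negf)
    then show ?thesis using assms(1) by (simp only: mult_le_cancel_left_pos of_nat_0_less_iff)
  qed
  have decM: "decseq M"
    unfolding M_def using S step gM1
    by (intro decseq_Max[where G = g]) (force simp: M_def g_def)+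
  have decM': "decseq M'"
    unfolding M'_def using S step gM2
    by (intro decseq_Max[where G = "\<lambda>t. - g t"]) (force simp: M'_def g_def)+
  \<comment> \<open>Each of the two decreasing sequences supplies a lower bound for the
    other.\<close>
  have "- M' 0 \<le> M t" for t using M'M[of t] decseqD[OF decM', of 0 t] by simp
  then obtain L where L: "M \<longlonglongrightarrow> L" "\<And>t. L \<le> M t"
    using decseq_convergent[OF decM] by metis
  have "- M 0 \<le> M' t" for t using M'M[of t] decseqD[OF decM, of 0 t] by simp
  then obtain L' where L': "M' \<longlonglongrightarrow> L'" "\<And>t. L' \<le> M' t"
    using decseq_convergent[OF decM'] by metis
  have "\<exists>\<^sub>F t in sequentially. L \<le> g t"
  proof (rule frequently_ge_if_Max_ge[OF S, where h = h])
    show "h (Suc t) i = h t i \<or> h (Suc t) i \<le> g t" if "i \<in> {..<n}" for t i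
      using step[of i t] that by (auto simp: g_def)
    show "infinite {t. h (Suc t) i \<le> g t}" if "i \<in> {..<n}" for i
    proof (rule infinite_super[OF _ moves[of i]])
      show "{t. h (Suc t) i = (1 / real n) * (\<Sum>j<n. h t j)} \<subseteq> {t. h (Suc t) i \<le> g t}"
        by (auto simp: g_def)
    qed (use that in simp)
    show "L \<le> Max (h t ` {..<n})" for t using L(2) by (simp add: M_def)
  qed
  then have freq: "\<exists>\<^sub>F t in sequentially. real n * L \<le> (real n - 1) * M t - M' t"
  proof (rule frequently_elim1)
    fix t assume "L \<le> g t"
    then have "real n * L \<le> real n * g t" by (simp add: mult_left_mono)
    then show "real n * L \<le> (real n - 1) * M t - M' t" using gM[of t] by linarith
  qed
  \<comment> \<open>This is the limit of an inequality known at infinitely many times. It amounts to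
    \<open>L \<le> - L'\<close>: the limit of the minima is at least that of the maxima.\<close>
  have "real n * L \<le> (real n - 1) * L - L'"
  proof (rule ccontr)
    assume "\<not> ?thesis"
    moreover have "(\<lambda>t. (real n - 1) * M t - M' t) \<longlonglongrightarrow> (real n - 1) * L - L'"
      using L(1) L'(1) by (intro tendsto_intros)
    ultimately have "\<forall>\<^sub>F t in sequentially. (real n - 1) * M t - M' t < real n * L"
      by (intro order_tendstoD) auto
    then show False using freq by (simp add: frequently_def not_le)
  qed
  moreover have "- L' \<le> L"
    using LIMSEQ_le[OF tendsto_minus[OF L'(1)] L(1)] M'M by blast
  ultimately have "- L' = L" by (simp add: algebra_simps)
  then have "(\<lambda>t. - M' t) \<longlonglongrightarrow> L" using tendsto_minus[OF L'(1)] by simp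
  then have "(\<lambda>t. h t i) \<longlonglongrightarrow> L" if i: "i < n" for i
  proof (rule tendsto_sandwich[rotated 2])
    show "M \<longlonglongrightarrow> L" by (rule L(1))
    show "\<forall>\<^sub>F t in sequentially. - M' t \<le> h t i"
      by (rule always_eventually) (use M(2)[OF i] in \<open>simp add: minus_le_iff\<close>)
    show "\<forall>\<^sub>F t in sequentially. h t i \<le> M t"
      by (rule always_eventually) (use M(1)[OF i] in simp)
  qed
  then show ?thesis by blast
qed

lemma averaging_converges:
  fixes x :: "nat \<Rightarrow> nat \<Rightarrow> point"
  assumes "0 < n"
    and step: "\<And>t i. i < n \<Longrightarrow> x (Suc t) i = x t i \<or> x (Suc t) i = centroid (configuration n (x t))"
    and moves: "\<And>i. i < n \<Longrightarrow> infinite {t. x (Suc t) i = centroid (configuration n (x t))}"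
  shows "\<exists>p. \<forall>i<n. (\<lambda>t. x t i) \<longlonglongrightarrow> p"
proof -
  have g: "centroid (configuration n (x t)) $ k = (1 / real n) * (\<Sum>j<n. x t j $ k)" for t k
    by (simp add: centroid_configuration)
  have "\<exists>l. \<forall>i<n. (\<lambda>t. x t i $ k) \<longlonglongrightarrow> l" for k
  proof (rule averaging_coordinate_converges[OF assms(1)])
    show "x (Suc t) i $ k = x t i $ k \<or> x (Suc t) i $ k = (1 / real n) * (\<Sum>j<n. x t j $ k)"
      if "i < n" for t i
      using step[OF that, of t] g[of t k] by metis
    show "infinite {t. x (Suc t) i $ k = (1 / real n) * (\<Sum>j<n. x t j $ k)}" if "i < n" for i
      by (rule infinite_super[OF _ moves[OF that]]) (use g in auto)
  qed
  then obtain l where "\<And>k i. i < n \<Longrightarrow> (\<lambda>t. x t i $ k) \<longlonglongrightarrow> l k" by metis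
  then have "\<forall>i<n. (\<lambda>t. x t i) \<longlonglongrightarrow> (\<chi> k. l k)"
    by (auto intro!: vec_tendstoI)
  then show ?thesis ..
qed

text \<open>The deviations of the robots in \<open>C\<close> from their mean \<open>c\<close>
  cancel, so only \<open>S\<close> pulls the centroid away from \<open>c\<close>: its distance is at
  most \<open>q\<close> times the maximal distance in \<open>S\<close>, where
  \<open>q = card S / n < 1\<close>.\<close>

lemma averaging_converges_to_stationary_mean:
  fixes x :: "nat \<Rightarrow> nat \<Rightarrow> point"
  assumes "C \<subseteq> {..<n}" "C \<noteq> {}" "S = {..<n} - C"
    and stationary: "\<And>t i. i \<in> C \<Longrightarrow> x t i = y i"
    and step: "\<And>t i. i \<in> S \<Longrightarrow> x (Suc t) i = x t i \<or> x (Suc t) i = centroid (configuration n (x t))"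
    and moves: "\<And>i. i \<in> S \<Longrightarrow> infinite {t. x (Suc t) i = centroid (configuration n (x t))}"
    and "i \<in> S"
  shows "(\<lambda>t. x t i) \<longlonglongrightarrow> (1 / real (card C)) *\<^sub>R (\<Sum>j\<in>C. y j)"
proof -
  define c where "c = (1 / real (card C)) *\<^sub>R (\<Sum>j\<in>C. y j)"
  define h where "h t i = norm (x t i - c)" for t i
  define M where "M t = Max (h t ` S)" for t
  define q where "q = real (card S) / real n"
  have S: "finite S" "S \<noteq> {}" using assms(3,7) by auto
  have "finite C" using assms(1) finite_subset by blast
  then have "0 < card C" using assms(2) by (simp add: card_gt_0_iff)
  have card: "card S + card C = n"
    using card_Diff_subset[OF \<open>finite C\<close> assms(1)] card_mono[OF _ assms(1)] assms(3) by simp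
  then have "0 < n" "q < 1" using \<open>0 < card C\<close> by (auto simp: q_def)
  have "0 \<le> q" by (simp add: q_def)
  have M: "h t i \<le> M t" if "i \<in> S" for t i using S that by (auto simp: M_def)
  have M0: "0 \<le> M t" for t using M[OF assms(7), of t] by (simp add: h_def order_trans[OF norm_ge_zero])
  have qM: "q * M t \<le> M t" for t using M0[of t] \<open>q < 1\<close> by (simp add: mult_left_le_one_le \<open>0 \<le> q\<close>)
  have g: "norm (centroid (configuration n (x t)) - c) \<le> q * M t" for t
  proof -
    have "(\<Sum>j<n. x t j) = (\<Sum>j\<in>S. x t j) + (\<Sum>j\<in>C. x t j)"
      unfolding assms(3) by (rule sum.subset_diff) (use assms(1) in auto)
    also have "(\<Sum>j\<in>C. x t j) = real (card C) *\<^sub>R c"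
      using stationary \<open>0 < card C\<close> by (simp add: c_def)
    finally have "(\<Sum>j<n. x t j) - real n *\<^sub>R c = (\<Sum>j\<in>S. x t j - c)"
      by (simp add: sum_subtractf sum_constant_scaleR card[symmetric] algebra_simps del: sum_constant)
    moreover have "centroid (configuration n (x t)) - c = (1 / real n) *\<^sub>R ((\<Sum>j<n. x t j) - real n *\<^sub>R c)"
      using \<open>0 < n\<close> by (simp add: centroid_configuration algebra_simps)
    ultimately have "norm (centroid (configuration n (x t)) - c) = (1 / real n) * norm (\<Sum>j\<in>S. x t j - c)"
      by simp
    also have "\<dots> \<le> (1 / real n) * (real (card S) * M t)"
      using M by (intro mult_left_mono sum_norm_bound) (auto simp: h_def)
    finally show ?thesis by (simp add: q_def)
  qed
  have h_step: "h (Suc t) i = h t i \<or> h (Suc t) i \<le> q * M t" if "i \<in> S" for t i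
    using step[OF that, of t] g[of t] by (auto simp: h_def)
  have h_moves: "infinite {t. h (Suc t) i \<le> q * M t}" if "i \<in> S" for i
    by (rule infinite_super[OF _ moves[OF that]]) (use g in \<open>auto simp: h_def\<close>)
  have "decseq M"
    unfolding M_def using S h_step qM
    by (intro decseq_Max[where G = "\<lambda>t. q * M t"]) (auto simp: M_def)
  then obtain L where L: "M \<longlonglongrightarrow> L" "\<And>t. L \<le> M t"
    using decseq_convergent M0 by metis
  have freq: "\<exists>\<^sub>F t in sequentially. L \<le> q * M t"
    using frequently_ge_if_Max_ge[OF S, of h "\<lambda>t. q * M t" L] h_step h_moves L(2)
    by (simp add: M_def)
  \<comment> \<open>For \<open>L > 0\<close> the bound \<open>q * M t\<close> tends to
    \<open>q * L < L\<close>, so it could not return to \<open>L\<close> infinitely often.\<close>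
  have "L \<le> 0"
  proof (rule ccontr)
    assume "\<not> L \<le> 0"
    then have "q * L < L" using \<open>q < 1\<close> by simp
    then have "\<forall>\<^sub>F t in sequentially. q * M t < L"
      using L(1) by (intro order_tendstoD(2)[of _ "q * L"] tendsto_intros)
    then show False using freq by (simp add: frequently_def not_le)
  qed
  moreover have "0 \<le> L" using LIMSEQ_le_const[OF L(1)] M0 by blast
  ultimately have "M \<longlonglongrightarrow> 0" using L(1) by simp
  then have "(\<lambda>t. x t i - c) \<longlonglongrightarrow> 0"
    by (rule Lim_null_comparison[rotated]) (use M[OF assms(7)] in \<open>simp add: h_def\<close>)
  then show ?thesis unfolding c_def[symmetric] by (rule LIM_zero_cancel)
qed

text \<open>\<open>C\<close> collects the robots that are found on the preceding centroid only
  finitely often. This is read off positions alone, so a robot resting on the centroid counts as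
  hitting it. Finiteness of \<open>C\<close> yields one time \<open>T\<close> after all its
  hits.\<close>

lemma averaging_cases:
  fixes x :: "nat \<Rightarrow> nat \<Rightarrow> point"
  assumes "0 < n"
    and step: "\<And>t i. i < n \<Longrightarrow> x (Suc t) i = x t i \<or> x (Suc t) i = centroid (configuration n (x t))"
  obtains (all_converge) p where "\<And>i. i < n \<Longrightarrow> (\<lambda>t. x t i) \<longlonglongrightarrow> p"
  | (some_stationary) C T y where "C \<subseteq> {..<n}" "C \<noteq> {}"
      "\<And>t i. T \<le> t \<Longrightarrow> i \<in> C \<Longrightarrow> x t i = y i \<and> x (Suc t) i \<noteq> centroid (configuration n (x t))"
      "\<And>i. i < n \<Longrightarrow> i \<notin> C \<Longrightarrow> (\<lambda>t. x t i) \<longlonglongrightarrow> (1 / real (card C)) *\<^sub>R (\<Sum>j\<in>C. y j)"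
proof -
  let ?g = "\<lambda>t. centroid (configuration n (x t))"
  define C where "C = {i. i < n \<and> finite {t. x (Suc t) i = ?g t}}"
  show thesis
  proof (cases "C = {}")
    case True
    then have "\<And>i. i < n \<Longrightarrow> infinite {t. x (Suc t) i = ?g t}" by (auto simp: C_def)
    then show thesis using averaging_converges[of n x, OF assms] all_converge by blast
  next
    case False
    have "finite C" by (simp add: C_def)
    have "\<forall>\<^sub>F t in sequentially. \<forall>i\<in>C. x (Suc t) i \<noteq> ?g t"
      using \<open>finite C\<close>
      by (simp add: eventually_ball_finite_distrib C_def flip: cofinite_eq_sequentially)
        (simp add: eventually_cofinite)
    then obtain T where T: "\<And>t i. T \<le> t \<Longrightarrow> i \<in> C \<Longrightarrow> x (Suc t) i \<noteq> ?g t"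
      by (auto simp: eventually_sequentially)
    have const: "x t i = x T i" if "T \<le> t" "i \<in> C" for t i
      using that(1)
    proof (induction t rule: dec_induct)
      case (step t)
      then show ?case using T[of t i] assms(2)[of i t] that(2) by (auto simp: C_def)
    qed simp
    show thesis
    proof (rule some_stationary)
      show "C \<subseteq> {..<n}" by (auto simp: C_def)
      show "C \<noteq> {}" by fact
      show "x t i = x T i \<and> x (Suc t) i \<noteq> ?g t" if "T \<le> t" "i \<in> C" for t i
        using const T that by blast
      fix i assume i: "i < n" "i \<notin> C"
      \<comment> \<open>Time is shifted by \<open>T\<close> to make \<open>C\<close> stationary from
        the start; this discards at most \<open>T\<close> hits of any other robot.\<close>
      have "(\<lambda>t. x (t + T) i) \<longlonglongrightarrow> (1 / real (card C)) *\<^sub>R (\<Sum>j\<in>C. x T j)"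
      proof (rule averaging_converges_to_stationary_mean[where x = "\<lambda>t. x (t + T)", OF \<open>C \<subseteq> {..<n}\<close> False refl])
        show "x (t + T) j = x T j" if "j \<in> C" for t j using const[of "t + T"] that by simp
        show "x (Suc t + T) j = x (t + T) j \<or> x (Suc t + T) j = ?g (t + T)"
          if "j \<in> {..<n} - C" for t j
          using step[of j "t + T"] that by simp
        show "infinite {t. x (Suc t + T) j = ?g (t + T)}" if "j \<in> {..<n} - C" for j
        proof
          assume fin: "finite {t. x (Suc t + T) j = ?g (t + T)}"
          have "{t. x (Suc t) j = ?g t} \<subseteq> {..<T} \<union> (\<lambda>t. t + T) ` {t. x (Suc t + T) j = ?g (t + T)}"
          proof
            fix t assume "t \<in> {t. x (Suc t) j = ?g t}"
            then show "t \<in> {..<T} \<union> (\<lambda>t. t + T) ` {t. x (Suc t + T) j = ?g (t + T)}"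
              by (cases "t < T") (auto intro!: image_eqI[of _ _ "t - T"])
          qed
          then have "finite {t. x (Suc t) j = ?g t}" using fin finite_subset by blast
          then show False using that by (simp add: C_def)
        qed
        show "i \<in> {..<n} - C" using i by simp
      qed
      then show "(\<lambda>t. x t i) \<longlonglongrightarrow> (1 / real (card C)) *\<^sub>R (\<Sum>j\<in>C. x T j)"
        by (rule LIMSEQ_offset)
    qed
  qed
qed

section \<open>Compatibility\<close>

lemma execution_step:
  assumes "execution n \<phi> u \<theta> active crash x" "i < n"
  shows "x (Suc t) i = x t i \<or> x (Suc t) i = destination n (\<phi> i) (u i) (\<theta> i) (x t) i"
  using assms by (auto simp: execution_def)

lemma nonfaulty_moves:
  assumes "execution n \<phi> u \<theta> active crash x" "fair n active" "i < n" "i \<notin> faulty n crash"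
  obtains t where "T \<le> t" "x (Suc t) i = destination n (\<phi> i) (u i) (\<theta> i) (x t) i"
proof -
  have "infinite {t. i \<in> active t}" using assms(2,3) by (simp add: fair_def)
  then obtain t where "T \<le> t" "i \<in> active t"
    by (auto simp: infinite_nat_iff_unbounded_le)
  moreover have "\<not> crashed crash t i" using assms(3,4) by (simp add: faulty_def crashed_def)
  ultimately show thesis using assms(1,3) by (intro that[of t]) (simp_all add: execution_def)
qed

text \<open>Once a majority point occurs, it is the target of everybody forever. If none ever
  occurs, the rule is the pure centroid rule.\<close>

lemma FC_compatible_join_majority:
  assumes n: "3 \<le> n"
  shows "FC_compatible n f {target_to (join_majority n)}"
  unfolding FC_compatible_def
proof (intro allI impI, elim conjE)
  fix \<phi> :: "nat \<Rightarrow> target_fun" and u \<theta> :: "nat \<Rightarrow> real" and active crash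
  fix x :: "nat \<Rightarrow> nat \<Rightarrow> point"
  assume \<phi>: "\<forall>i<n. \<phi> i \<in> {target_to (join_majority n)}" and u: "\<forall>i<n. 0 < u i"
    and fair: "fair n active" and ex: "execution n \<phi> u \<theta> active crash x"
  let ?p = "\<lambda>t. join_majority n (configuration n (x t))"
  have dest: "destination n (\<phi> i) (u i) (\<theta> i) (x t) i = ?p t" if "i < n" for t i
    using destination_join_majority[OF n] \<phi> u that by simp
  have move: "x (Suc t) i = x t i \<or> x (Suc t) i = ?p t" if "i < n" for t i
    using execution_step[OF ex that, of t] dest[OF that] by simp
  show "\<exists>p. \<forall>i<n. i \<notin> faulty n crash \<longrightarrow> (\<lambda>t. x t i) \<longlonglongrightarrow> p"
  proof (cases "\<exists>t a. majority n (configuration n (x t)) a")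
    case True
    then obtain s a where "majority n (configuration n (x s)) a" by blast
    then obtain b where b: "b < n" "\<forall>j<n. j \<noteq> b \<longrightarrow> x s j = a"
      by (auto simp: majority_configuration)
    have p: "?p t = a" if "\<forall>j<n. j \<noteq> b \<longrightarrow> x t j = a" for t
      using that b(1) n by (intro join_majority_eq) (auto simp: majority_configuration)
    \<comment> \<open>The robots other than \<open>b\<close> have their own position as target;
      whether \<open>b\<close> stays or joins them does not affect the pattern.\<close>
    have "\<forall>j<n. j \<noteq> b \<longrightarrow> x t j = a" if "s \<le> t" for t
      using that
    proof (induction t rule: dec_induct)
      case (step t)
      then show ?case using move p[of t] by metis
    qed (rule b(2))
    then have pa: "?p t = a" if "s \<le> t" for t using p that by blast
    have "(\<lambda>t. x t i) \<longlonglongrightarrow> a" if i: "i < n" "i \<notin> faulty n crash" for i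
    proof -
      obtain r where r: "s \<le> r" "x (Suc r) i = ?p r"
        using nonfaulty_moves[OF ex fair i, of s] dest[OF i(1)] by metis
      have "x t i = a" if "Suc r \<le> t" for t
        using that
      proof (induction t rule: dec_induct)
        case base
        then show ?case using r pa by simp
      next
        case (step t)
        then show ?case using move[OF i(1), of t]
          pa[of t] r(1) by auto
      qed
      then show ?thesis
        by (intro tendsto_eventually) (auto simp: eventually_sequentially)
    qed
    then show ?thesis by blast
  next
    case False
    then have p: "?p t = centroid (configuration n (x t))" for t by (simp add: join_majority_def)
    have "0 < n" using n by simp
    then show ?thesis
    proof (rule averaging_cases[of n x])
      show "x (Suc t) i = x t i \<or> x (Suc t) i = centroid (configuration n (x t))" if "i < n" for t i
        using move[OF that, of t] p by simp
    next
      fix p assume "\<And>i. i < n \<Longrightarrow> (\<lambda>t. x t i) \<longlonglongrightarrow> p"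
      then show ?thesis by blast
    next
      fix C :: "nat set" and T :: nat and y :: "nat \<Rightarrow> point"
      assume st: "\<And>t i. T \<le> t \<Longrightarrow> i \<in> C \<Longrightarrow> x t i = y i \<and> x (Suc t) i \<noteq> centroid (configuration n (x t))"
        and lim: "\<And>i. i < n \<Longrightarrow> i \<notin> C \<Longrightarrow> (\<lambda>t. x t i) \<longlonglongrightarrow> (1 / real (card C)) *\<^sub>R (\<Sum>j\<in>C. y j)"
      \<comment> \<open>A non-faulty robot lands on the centroid at arbitrarily late times, which
        membership in \<open>C\<close> excludes from \<open>T\<close> on.\<close>
      have "i \<notin> C" if i: "i < n" "i \<notin> faulty n crash" for i
        using nonfaulty_moves[OF ex fair i, of T] st dest[OF i(1)] p by metis
      then show ?thesis using lim by blast
    qed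
  qed
qed

text \<open>
  A non-faulty robot \<open>i\<close> that is eventually stationary sees the others in one place infinitely
  often. If a second robot \<open>i'\<close> is stationary as well, this place is \<open>y i'\<close>; a third robot that
  keeps moving must converge both to \<open>y i'\<close> and to the mean of \<open>C\<close>, hence \<open>y i = y i'\<close>.
\<close>

lemma FC_compatible_stay_alone:
  assumes n: "3 \<le> n"
  shows "FC_compatible n f {target_to (stay_alone n)}"
  unfolding FC_compatible_def
proof (intro allI impI, elim conjE)
  fix \<phi> :: "nat \<Rightarrow> target_fun" and u \<theta> :: "nat \<Rightarrow> real" and active crash
  fix x :: "nat \<Rightarrow> nat \<Rightarrow> point"
  assume \<phi>: "\<forall>i<n. \<phi> i \<in> {target_to (stay_alone n)}" and u: "\<forall>i<n. 0 < u i"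
    and fair: "fair n active" and ex: "execution n \<phi> u \<theta> active crash x"
  let ?g = "\<lambda>t. centroid (configuration n (x t))"
  let ?alone = "\<lambda>t i a. \<forall>j<n. j \<noteq> i \<longrightarrow> x t j = a"
  have dest: "destination n (\<phi> i) (u i) (\<theta> i) (x t) i = (if \<exists>a. ?alone t i a then x t i else ?g t)"
    if "i < n" for t i
    using destination_stay_alone[OF that] \<phi> u that by simp
  have "0 < n" using n by simp
  then show "\<exists>p. \<forall>i<n. i \<notin> faulty n crash \<longrightarrow> (\<lambda>t. x t i) \<longlonglongrightarrow> p"
  proof (rule averaging_cases[of n x])
    show "x (Suc t) i = x t i \<or> x (Suc t) i = ?g t" if "i < n" for t i
      using execution_step[OF ex that, of t] dest[OF that, of t] by (auto split: if_splits)
  next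
    fix p assume "\<And>i. i < n \<Longrightarrow> (\<lambda>t. x t i) \<longlonglongrightarrow> p"
    then show ?thesis by blast
  next
    fix C :: "nat set" and T :: nat and y :: "nat \<Rightarrow> point"
    let ?c = "(1 / real (card C)) *\<^sub>R (\<Sum>j\<in>C. y j)"
    assume C: "C \<subseteq> {..<n}" "C \<noteq> {}"
      and st: "\<And>t i. T \<le> t \<Longrightarrow> i \<in> C \<Longrightarrow> x t i = y i \<and> x (Suc t) i \<noteq> ?g t"
      and lim: "\<And>i. i < n \<Longrightarrow> i \<notin> C \<Longrightarrow> (\<lambda>t. x t i) \<longlonglongrightarrow> ?c"
    \<comment> \<open>When activated after \<open>T\<close>, such a robot does not land on the
      centroid, so the staying branch must have applied.\<close>
    have alone: "\<exists>t\<ge>S. \<exists>a. ?alone t i a" if i: "i \<in> C" "i \<notin> faulty n crash" and "T \<le> S" for i S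
    proof -
      have "i < n" using i(1) C(1) by auto
      obtain t where t: "S \<le> t" "x (Suc t) i = destination n (\<phi> i) (u i) (\<theta> i) (x t) i"
        using nonfaulty_moves[OF ex fair \<open>i < n\<close> i(2)] .
      have "\<exists>a. ?alone t i a"
        using t dest[OF \<open>i < n\<close>, of t] st[OF _ i(1), of t] that(3) by (auto split: if_splits)
      then show ?thesis using t(1) by blast
    qed
    have limC: "(\<lambda>t. x t i) \<longlonglongrightarrow> y i" if "i \<in> C" for i
      using st that by (intro tendsto_eventually) (auto simp: eventually_sequentially)
    show ?thesis
    proof (cases "\<exists>i\<in>C. i \<notin> faulty n crash")
      case False
      \<comment> \<open>All of \<open>C\<close> is faulty here, so the mean \<open>?c\<close> is the
        common limit.\<close>
      then show ?thesis using lim by blast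
    next
      case True
      then obtain i where i: "i \<in> C" "i \<notin> faulty n crash" by blast
      have "i < n" using i(1) C(1) by auto
      have "finite C" using C(1) finite_subset by blast
      have "(\<lambda>t. x t k) \<longlonglongrightarrow> y i" if k: "k < n" "k \<notin> faulty n crash" for k
      proof (cases "C = {i}")
        case True
        \<comment> \<open>With a single stationary robot, \<open>?c\<close> is \<open>y i\<close>
          itself.\<close>
        then show ?thesis using limC[OF i(1)] lim[OF k(1)] by (cases "k = i") auto
      next
        case False
        then obtain i' where i': "i' \<in> C" "i' \<noteq> i" using i(1) by blast
        then have "i' < n" using C(1) by auto
        have others: "\<exists>t\<ge>S. ?alone t i (y i')" if TS: "T \<le> S" for S
        proof -
          obtain t a where "S \<le> t" "?alone t i a" using alone[OF i TS] by blast
          moreover from this have "a = y i'" using st[of t i'] i' \<open>i' < n\<close> TS by auto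
          ultimately show ?thesis by blast
        qed
        \<comment> \<open>At a late time when \<open>i\<close> sees the others in one place, that
          place also holds every other robot of \<open>C\<close>.\<close>
        have yC: "y j = y i'" if "j \<in> C" "j \<noteq> i" for j
          using others[of T] st[of _ j] that C(1) by auto
        \<comment> \<open>Robot \<open>j\<close> is at \<open>y i'\<close> infinitely often, so its
          limit \<open>?c\<close> equals \<open>y i'\<close>. Thus \<open>y i\<close> and
          \<open>card C - 1\<close> copies of \<open>y i'\<close> have mean \<open>y i'\<close>,
          which forces \<open>y i = y i'\<close>.\<close>
        have key: "?c = y i' \<and> y i = y i'" if j: "j < n" "j \<notin> C" for j
        proof -
          have "\<exists>\<^sub>F t in sequentially. x t j = y i'"
            unfolding frequently_sequentially
          proof
            fix S
            obtain t where "max S T \<le> t" "?alone t i (y i')" using others[of "max S T"] by auto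
            then show "\<exists>t\<ge>S. x t j = y i'" using j i(1) by auto
          qed
          then have c: "?c = y i'"
            using limit_frequently_eq[OF _ _ lim[OF j]] by auto
          have "(\<Sum>j\<in>C. y j) = y i + (\<Sum>j\<in>C - {i}. y i')"
            using \<open>finite C\<close> i(1) yC by (simp add: sum.remove[of _ i] del: sum_constant)
          also have "\<dots> = y i + real (card C - 1) *\<^sub>R y i'"
            using \<open>finite C\<close> i(1) by (simp add: sum_constant_scaleR del: sum_constant)
          also have "(\<Sum>j\<in>C. y j) = real (card C) *\<^sub>R y i'"
            using c \<open>finite C\<close> C(2) by (simp flip: c)
          finally have "y i = real (card C) *\<^sub>R y i' - real (card C - 1) *\<^sub>R y i'"
            by simp
          also have "\<dots> = y i'"
            using \<open>finite C\<close> C(2) by (simp add: of_nat_diff card_gt_0_iff Suc_leI algebra_simps)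
          finally show ?thesis using c by simp
        qed
        show ?thesis
        proof (cases "k \<in> C")
          case False
          then show ?thesis using key[OF k(1)] lim[OF k(1)] by simp
        next
          case True
          \<comment> \<open>Since \<open>3 \<le> n\<close> there is a third robot \<open>j\<close>.
            If it is outside \<open>C\<close>, \<open>key\<close> applies; otherwise
            \<open>k\<close> too sees its others in one place at some late time, so \<open>i\<close>
            and \<open>j\<close> coincide.\<close>
          have "y i = y i'" if "k \<noteq> i"
          proof -
            have "\<not> {..<n} \<subseteq> {i, k}"
              using n card_mono[of "{i, k}" "{..<n}"] that by auto
            then obtain j where j: "j < n" "j \<noteq> i" "j \<noteq> k" by auto
            show ?thesis
            proof (cases "j \<in> C")
              case False
              then show ?thesis using key j(1) by blast
            next
              case True
              obtain t a where "T \<le> t" "?alone t k a" using alone[OF \<open>k \<in> C\<close> k(2), of T] by auto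
              then have "y i = y j"
                using st[of t i] st[of t j] i(1) True j \<open>i < n\<close> that by auto
              then show ?thesis using yC[OF True j(2)] by simp
            qed
          qed
          then show ?thesis using limC[OF True] yC[OF True] by (cases "k = i") auto
        qed
      qed
      then show ?thesis by blast
    qed
  qed
qed

lemma not_FC_compatible_mixed:
  assumes n: "3 \<le> n"
  shows "\<not> FC_compatible n f {target_to (join_majority n), target_to (stay_alone n)}"
proof
  assume FC: "FC_compatible n f {target_to (join_majority n), target_to (stay_alone n)}"
  define a where "a = (axis 1 1 :: point)"
  define pos where "pos i = (if i = 0 then a else 0)" for i :: nat
  define \<phi> where "\<phi> i = target_to (if i = 0 then stay_alone n else join_majority n)" for i :: nat
  have "majority n (configuration n pos) 0"
    using n by (auto simp: majority_configuration pos_def intro!: exI[of _ 0])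
  then have "join_majority n (configuration n pos) = 0"
    using n join_majority_eq by blast
  \<comment> \<open>Robot 0 sees all others at the origin and stays; the others already stand on the
    majority point.\<close>
  then have "destination n (\<phi> i) 1 0 pos i = pos i" if "i < n" for i
    using that n by (auto simp: \<phi>_def destination_join_majority destination_stay_alone pos_def)
  then have "execution n \<phi> (\<lambda>_. 1) (\<lambda>_. 0) (\<lambda>_. UNIV) (\<lambda>_. None) (\<lambda>_. pos)"
    by (simp add: execution_def)
  moreover have "fair n (\<lambda>_. UNIV)" by (simp add: fair_def)
  moreover have "faulty n (\<lambda>_. None) = {}" by (simp add: faulty_def)
  moreover have "\<forall>i<n. \<phi> i \<in> {target_to (join_majority n), target_to (stay_alone n)}"
    by (simp add: \<phi>_def)
  ultimately obtain p where p: "\<And>i. i < n \<Longrightarrow> (\<lambda>_::nat. pos i) \<longlonglongrightarrow> p"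
    using FC[unfolded FC_compatible_def, rule_format,
        of \<phi> "\<lambda>_. 1" "\<lambda>_. UNIV" "\<lambda>_. None" "\<lambda>_. 0" "\<lambda>_. pos"] by auto
  have "pos 0 = p" "pos 1 = p"
    using p[of 0] p[of 1] n by (auto simp: LIMSEQ_const_iff)
  then show False by (simp add: pos_def a_def axis_eq_0_iff)
qed

theorem corollary4:
  fixes n f :: nat
  assumes "2 \<le> f" and "f \<le> n - 1"
  shows "\<exists>\<xi> \<xi>'. target_function n \<xi> \<and> target_function n \<xi>' \<and>
           target_scale n \<xi> = 1 \<and> target_scale n \<xi>' = 1 \<and>
           FC_compatible n f {\<xi>} \<and> FC_compatible n f {\<xi>'} \<and>
           \<not> FC_compatible n f ({\<xi>} \<union> {\<xi>'})"
proof (intro exI conjI)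
  have n: "3 \<le> n" using assms by simp
  show "target_function n (target_to (join_majority n))" "target_function n (target_to (stay_alone n))"
    by (rule target_function_target_to)+
  show "target_scale n (target_to (join_majority n)) = 1"
    by (rule target_scale_join_majority[OF n])
  show "target_scale n (target_to (stay_alone n)) = 1"
    by (rule target_scale_stay_alone[OF n])
  show "FC_compatible n f {target_to (join_majority n)}"
    by (rule FC_compatible_join_majority[OF n])
  show "FC_compatible n f {target_to (stay_alone n)}"
    by (rule FC_compatible_stay_alone[OF n])
  show "\<not> FC_compatible n f ({target_to (join_majority n)} \<union> {target_to (stay_alone n)})"
    using not_FC_compatible_mixed[OF n] by (metis insert_is_Un)
qed

end
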